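(* Let $\mathcal{V}$ be a normed finite dimensional real vector space, let $\mathcal{C}\subseteq\mathcal{V}$ be an open convex cone, and let $\mathcal{D}\subseteq\mathcal{V}$ be a cone of directions (in particular $\mathcal{D}$ spans $\mathcal{V}$). If $f\colon\mathcal{C}\to\mathbb{R}$ is $\mathcal{D}$-convex and positively $1$-homogeneous, then $f$ is convex at each point of $\mathcal{C}\cap\mathcal{D}$; that is, for each $x_0\in\mathcal{C}\cap\mathcal{D}$ there exists a linear function $\ell\colon\mathcal{V}\to\mathbb{R}$ satisfying $\ell(x_0)=f(x_0)$ and $f(x)\geq\ell(x)$ for all $x\in\mathcal{C}$.
   Context: An open convex cone $\mathcal{C}$ in $\mathcal{V}$ is an open subset such that $sx+ty\in\mathcal{C}$ whenever $s,t>0$ and $x,y\in\mathcal{C}$. A cone of directions $\mathcal{D}$ in $\mathcal{V}$ is a subset of $\mathcal{V}$ such that $tx\in\mathcal{D}$ for all $x\in\mathcal{D}$, $t\in\mathbb{R}$, and whose linear span is $\mathcal{V}$ (equivalently, it contains a basis of $\mathcal{V}$). A function $f\colon\mathcal{C}\to\mathbb{R}$ is $\mathcal{D}$-convex if its restriction to every line segment $[x,y]\subset\mathcal{C}$ with $x-y\in\mathcal{D}$ is convex. It is positively $1$-homogeneous if $f(tx)=tf(x)$ for all $t>0$ and $x\in\mathcal{C}$. *)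

theory Defs
  imports "HOL-Analysis.Analysis"
begin

definition finite_dimensional_space :: "'a::real_vector itself \<Rightarrow> bool" where
  "finite_dimensional_space _ \<longleftrightarrow> (\<exists>B :: 'a set. finite B \<and> span B = UNIV)"

text \<open>Unlike the library predicate \<open>cone\<close>, closure is required only under positive
  coefficients, so the origin need not belong to the set.\<close>

definition open_convex_cone :: "'a::real_normed_vector set \<Rightarrow> bool" where
  "open_convex_cone C \<longleftrightarrow> open C \<and>
     (\<forall>x\<in>C. \<forall>y\<in>C. \<forall>s t :: real. s > 0 \<longrightarrow> t > 0 \<longrightarrow> s *\<^sub>R x + t *\<^sub>R y \<in> C)"

definition cone_of_directions :: "'a::real_vector set \<Rightarrow> bool" where
  "cone_of_directions D \<longleftrightarrow> (\<forall>x\<in>D. \<forall>t :: real. t *\<^sub>R x \<in> D) \<and> span D = UNIV"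

text \<open>A function on \<open>C\<close> is represented by a total function; the two predicates below
  (and the theorem) only constrain its values on \<open>C\<close>.\<close>

definition directionally_convex_on ::
    "'a::real_vector set \<Rightarrow> 'a set \<Rightarrow> ('a \<Rightarrow> real) \<Rightarrow> bool" where
  "directionally_convex_on D C f \<longleftrightarrow>
     (\<forall>x y. closed_segment x y \<subseteq> C \<longrightarrow> x - y \<in> D \<longrightarrow> convex_on (closed_segment x y) f)"

definition positively_1_homogeneous_on ::
    "'a::real_vector set \<Rightarrow> ('a \<Rightarrow> real) \<Rightarrow> bool" where
  "positively_1_homogeneous_on C f \<longleftrightarrow> (\<forall>t>0. \<forall>x\<in>C. f (t *\<^sub>R x) = t * f x)"

end

theory Submission
  imports Defs
begin

text \<open>
  The supporting functional is built by replacing \<open>f\<close> repeatedly by its blow-up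
  \<open>g v = lim (f (v + t x0) - t f x0)\<close> as \<open>t\<close> tends to infinity. By homogeneity the expression
  equals \<open>(f (x0 + s v) - f x0) / s\<close> with \<open>s = 1 / t\<close>, so \<open>g\<close> is the one-sided directional
  derivative of \<open>f\<close> at \<open>x0\<close>; in the first form, however, directional convexity of \<open>g\<close> is
  immediate, because it involves only translates of \<open>f\<close>.

  Two facts make the blow-up work. First, \<open>f (x + x0) \<le> f x + f x0\<close> for \<open>x \<in> C\<close>
  (\<open>subadditive_along_direction\<close>): \<open>f\<close> is convex along the ray from \<open>x\<close> in direction \<open>x0\<close>,
  and its slope at infinity is \<open>lim f (x0 + x / t) = f x0\<close>. Hence the expression is decreasing
  in \<open>t\<close>, which gives \<open>g \<le> f\<close> on \<open>C\<close>. Secondly, the difference quotients are bounded below, so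
  \<open>g\<close> is finite. Both need control of \<open>f\<close> near \<open>x0\<close> along an arbitrary vector \<open>v\<close>, which need
  not be a direction of convexity; this is \<open>directionally_convex_Lipschitz_along_rays\<close>, and it is
  where the spanning property of \<open>D\<close> enters: \<open>v\<close> is a finite sum of elements of \<open>D\<close>, and the
  point \<open>x0 + s v\<close> is reached by that many steps in directions of convexity.

  The blow-up is again homogeneous and directionally convex, now on the whole space, agrees with
  \<open>f\<close> at \<open>x0\<close>, and is affine with slope \<open>f x0\<close> along every line in direction \<open>x0\<close>. So it can be
  blown up again at any \<open>y \<in> D\<close>; this can only lower the function, makes it affine along
  \<open>y\<close>, and keeps the earlier directions of linearity together with the values there. After
  running through a finite spanning subset of \<open>D\<close> the function is linear
  (\<open>iterated_blow_up\<close>, \<open>subspace_lineality\<close>). It lies below \<open>f\<close> on \<open>C\<close> and still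
  takes the value \<open>f x0\<close> at \<open>x0\<close>.
\<close>

section \<open>Directional convexity on convex sets\<close>

lemma open_convex_cone_scale:
  assumes "open_convex_cone C" "x \<in> C" "t > 0"
  shows "t *\<^sub>R x \<in> C"
proof -
  have "(t/2) *\<^sub>R x + (t/2) *\<^sub>R x \<in> C"
    using assms unfolding open_convex_cone_def by (meson half_gt_zero)
  then show ?thesis
    by (simp flip: scaleR_add_left)
qed

lemma open_convex_cone_add:
  assumes "open_convex_cone C" "x \<in> C" "y \<in> C"
  shows "x + y \<in> C"
proof -
  have "1 *\<^sub>R x + 1 *\<^sub>R y \<in> C"
    using assms unfolding open_convex_cone_def by (meson zero_less_one)
  then show ?thesis by simp
qed

lemma open_convex_cone_imp_convex:
  assumes "open_convex_cone C"
  shows "convex C"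
proof (rule convexI)
  fix x y and u v :: real
  assume "x \<in> C" "y \<in> C" "0 \<le> u" "0 \<le> v" "u + v = 1"
  then show "u *\<^sub>R x + v *\<^sub>R y \<in> C"
    using assms by (cases "u = 0 \<or> v = 0") (auto simp: open_convex_cone_def)
qed

lemma open_convex_cone_UNIV: "open_convex_cone UNIV"
  by (simp add: open_convex_cone_def)

lemma directionally_convex_onD:
  assumes "directionally_convex_on D C f" "closed_segment a b \<subseteq> C" "a - b \<in> D"
    and "0 \<le> u" "u \<le> 1"
  shows "f ((1 - u) *\<^sub>R a + u *\<^sub>R b) \<le> (1 - u) * f a + u * f b"
proof -
  have "convex_on (closed_segment a b) f"
    using assms by (auto simp: directionally_convex_on_def)
  then show ?thesis
    using assms by (intro convex_onD) auto
qed

text \<open>All chords of a segment in a direction from \<open>D\<close> again point in a direction from \<open>D\<close>, so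
  the convexity inequality need only be checked between the endpoints of segments.\<close>

lemma directionally_convex_onI:
  assumes D: "\<And>x t. x \<in> D \<Longrightarrow> t *\<^sub>R x \<in> D"
    and f: "\<And>a b u. closed_segment a b \<subseteq> C \<Longrightarrow> a - b \<in> D \<Longrightarrow> 0 < u \<Longrightarrow> u < 1 \<Longrightarrow>
      f ((1 - u) *\<^sub>R a + u *\<^sub>R b) \<le> (1 - u) * f a + u * f b"
  shows "directionally_convex_on D C f"
  unfolding directionally_convex_on_def
proof (intro allI impI)
  fix x y :: 'a
  assume xy: "closed_segment x y \<subseteq> C" "x - y \<in> D"
  show "convex_on (closed_segment x y) f"
  proof (intro convex_onI)
    fix u :: real and a b
    assume u: "0 < u" "u < 1" and ab: "a \<in> closed_segment x y" "b \<in> closed_segment x y"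
    from ab obtain r s where "a = (1 - r) *\<^sub>R x + r *\<^sub>R y" "b = (1 - s) *\<^sub>R x + s *\<^sub>R y"
      unfolding in_segment(1) by metis
    then have "a - b = ((1 - r) *\<^sub>R x + r *\<^sub>R y) - ((1 - s) *\<^sub>R x + s *\<^sub>R y)"
      by simp
    also have "\<dots> = (s - r) *\<^sub>R (x - y)"
      by (simp add: algebra_simps)
    finally have "a - b = (s - r) *\<^sub>R (x - y)" .
    moreover have "closed_segment a b \<subseteq> C"
      using ab xy(1) by (meson subset_closed_segment subset_trans)
    ultimately show "f ((1 - u) *\<^sub>R a + u *\<^sub>R b) \<le> (1 - u) * f a + u * f b"
      using f[of a b u] D[OF xy(2)] u by metis
  qed auto
qed

lemma spanning_cone_sum_list:
  assumes "cone_of_directions D"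
  obtains ys where "set ys \<subseteq> D" "sum_list ys = v"
proof -
  have "v \<in> span D"
    using assms by (simp add: cone_of_directions_def)
  then have "\<exists>ys. set ys \<subseteq> D \<and> sum_list ys = v"
  proof (induction rule: span_induct_alt)
    case base
    show ?case by (intro exI[of _ "[]"]) simp
  next
    case (step c x y)
    then obtain ys where "set ys \<subseteq> D" "sum_list ys = y" by blast
    then show ?case
      using step assms by (intro exI[of _ "c *\<^sub>R x # ys"]) (auto simp: cone_of_directions_def)
  qed
  then show thesis using that by blast
qed

section \<open>Lipschitz bounds along rays\<close>

text \<open>The zonotope of \<open>y\<^sub>1, \<dots>, y\<^sub>n\<close> is the image of the cube \<open>[-1,1]\<^sup>n\<close> under
  \<open>r \<mapsto> r\<^sub>1 y\<^sub>1 + \<dots> + r\<^sub>n y\<^sub>n\<close>. If all \<open>y\<^sub>i\<close> lie in \<open>D\<close>, its edges point in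
  directions of convexity; the vectors may be linearly dependent.\<close>

primrec zonotope :: "'a::real_vector list \<Rightarrow> 'a set" where
  "zonotope [] = {0}"
| "zonotope (y # ys) = {r *\<^sub>R y + b | r b. \<bar>r\<bar> \<le> 1 \<and> b \<in> zonotope ys}"

lemma zonotope_ConsI: "\<bar>r\<bar> \<le> 1 \<Longrightarrow> b \<in> zonotope ys \<Longrightarrow> r *\<^sub>R y + b \<in> zonotope (y # ys)"
  by auto

lemma zero_in_zonotope: "0 \<in> zonotope ys"
proof (induction ys)
  case (Cons y ys)
  then show ?case using zonotope_ConsI[of 0 0 ys y] by simp
qed simp

lemma norm_zonotope_le:
  fixes b :: "'a::real_normed_vector"
  assumes "b \<in> zonotope ys"
  shows "norm b \<le> (\<Sum>y\<leftarrow>ys. norm y)"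
  using assms
proof (induction ys arbitrary: b)
  case (Cons y ys)
  then obtain r c where b: "b = r *\<^sub>R y + c" "\<bar>r\<bar> \<le> 1" "c \<in> zonotope ys" by auto
  have "norm b \<le> \<bar>r\<bar> * norm y + norm c"
    using b(1) norm_triangle_ineq[of "r *\<^sub>R y" c] by simp
  also have "\<dots> \<le> 1 * norm y + (\<Sum>y\<leftarrow>ys. norm y)"
    using b Cons.IH by (intro add_mono mult_right_mono) auto
  finally show ?case by simp
qed simp

lemma segment_in_zonotope_translate:
  assumes z: "\<And>b. b \<in> zonotope (y # ys) \<Longrightarrow> z + b \<in> C"
    and c: "c \<in> zonotope ys" and "\<bar>p\<bar> \<le> 1" "\<bar>q\<bar> \<le> 1"
  shows "closed_segment (z + (p *\<^sub>R y + c)) (z + (q *\<^sub>R y + c)) \<subseteq> C"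
proof
  fix x assume "x \<in> closed_segment (z + (p *\<^sub>R y + c)) (z + (q *\<^sub>R y + c))"
  then obtain u where u: "0 \<le> u" "u \<le> 1"
    and x: "x = (1 - u) *\<^sub>R (z + (p *\<^sub>R y + c)) + u *\<^sub>R (z + (q *\<^sub>R y + c))"
    by (auto simp: closed_segment_def)
  have "x = z + (((1 - u) * p + u * q) *\<^sub>R y + c)"
    unfolding x by (simp add: algebra_simps)
  moreover have "\<bar>(1 - u) * p + u * q\<bar> \<le> 1"
  proof -
    have "(1 - u) * p + u * q \<le> 1" "- ((1 - u) * p + u * q) \<le> 1"
      using u assms convex_bound_le[of p 1 q "1-u" u] convex_bound_le[of "-p" 1 "-q" "1-u" u]
      by (auto simp: abs_le_iff)
    then show ?thesis by (simp add: abs_le_iff)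
  qed
  ultimately show "x \<in> C"
    using z c zonotope_ConsI by metis
qed

lemma directional_bound_zonotope:
  assumes D: "\<And>x t. x \<in> D \<Longrightarrow> t *\<^sub>R x \<in> D" and f: "directionally_convex_on D C f"
    and y: "y \<in> D" and z: "\<And>b. b \<in> zonotope (y # ys) \<Longrightarrow> z + b \<in> C"
    and c: "c \<in> zonotope ys" and pq: "\<bar>p\<bar> \<le> 1" "\<bar>q\<bar> \<le> 1" and u: "0 \<le> u" "u \<le> 1"
  shows "f (z + (((1 - u) * p + u * q) *\<^sub>R y + c))
    \<le> (1 - u) * f (z + (p *\<^sub>R y + c)) + u * f (z + (q *\<^sub>R y + c))"
proof -
  have "(z + (p *\<^sub>R y + c)) - (z + (q *\<^sub>R y + c)) = (p - q) *\<^sub>R y"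
    by (simp add: algebra_simps)
  then have "(z + (p *\<^sub>R y + c)) - (z + (q *\<^sub>R y + c)) \<in> D"
    using D y by metis
  from directionally_convex_onD[OF f segment_in_zonotope_translate[OF z c pq] this u]
  show ?thesis by (simp add: algebra_simps)
qed

text \<open>Convexity along the edge directions bounds \<open>f\<close> by its maximum over the vertices of the
  zonotope; the induction treats one edge direction at a time, passing from the point with
  coordinate \<open>r\<close> to the opposite facets with coordinates \<open>-1\<close> and \<open>1\<close>.\<close>

lemma bounded_above_on_zonotope:
  assumes D: "\<And>x t. x \<in> D \<Longrightarrow> t *\<^sub>R x \<in> D" and f: "directionally_convex_on D C f"
    and "set ys \<subseteq> D" and "\<And>b. b \<in> zonotope ys \<Longrightarrow> z + b \<in> C"
  shows "\<exists>M. \<forall>b\<in>zonotope ys. f (z + b) \<le> M"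
  using assms(3,4)
proof (induction ys arbitrary: z)
  case (Cons y ys)
  have sub: "(z + p *\<^sub>R y) + b \<in> C" if "\<bar>p\<bar> \<le> 1" "b \<in> zonotope ys" for p b
    using Cons.prems(2)[OF zonotope_ConsI[OF that]] by (simp add: add.assoc)
  obtain M1 where M1: "\<And>b. b \<in> zonotope ys \<Longrightarrow> f ((z + (-1) *\<^sub>R y) + b) \<le> M1"
    using Cons.IH[of "z + (-1) *\<^sub>R y"] Cons.prems(1) sub[of "-1"] by auto
  obtain M2 where M2: "\<And>b. b \<in> zonotope ys \<Longrightarrow> f ((z + 1 *\<^sub>R y) + b) \<le> M2"
    using Cons.IH[of "z + 1 *\<^sub>R y"] Cons.prems(1) sub[of "1"] by auto
  have "f (z + b) \<le> max M1 M2" if "b \<in> zonotope (y # ys)" for b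
  proof -
    from that obtain r c where b: "b = r *\<^sub>R y + c" "\<bar>r\<bar> \<le> 1" "c \<in> zonotope ys" by auto
    define u where "u = (1 + r) / 2"
    have u: "0 \<le> u" "u \<le> 1" using b(2) by (auto simp: u_def)
    have "r = (1 - u) * (-1) + u * 1" by (simp add: u_def field_simps)
    then have "f (z + b) \<le> (1 - u) * f (z + ((-1) *\<^sub>R y + c)) + u * f (z + (1 *\<^sub>R y + c))"
      using directional_bound_zonotope[OF D f _ Cons.prems(2) b(3),
          where p = "-1" and q = 1 and u = u] Cons.prems(1) u b(1)
      by simp
    also have "\<dots> \<le> max M1 M2"
      using M1[OF b(3), unfolded add.assoc] M2[OF b(3), unfolded add.assoc] u
      by (intro convex_bound_le) auto
    finally show ?thesis .
  qed
  then show ?case by blast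
qed auto

text \<open>The walk from \<open>z\<close> to \<open>z + s (y\<^sub>1 + \<dots> + y\<^sub>n)\<close> moves by \<open>s y\<^sub>i\<close> in the \<open>i\<close>-th step. Such a
  step ends at the convex combination, with weights \<open>1 - s\<close> and \<open>s\<close>, of its starting point and a
  point of the zonotope, where \<open>f \<le> M\<close>; so it contracts \<open>f - M\<close> by a factor \<open>1 - s\<close>.
  The same holds for the reversed walk, and this turns the upper bound \<open>M\<close> into a two-sided
  estimate.\<close>

lemma zonotope_walk:
  assumes D: "\<And>x t. x \<in> D \<Longrightarrow> t *\<^sub>R x \<in> D" and f: "directionally_convex_on D C f"
    and "set ys \<subseteq> D" and "\<And>b. b \<in> zonotope ys \<Longrightarrow> z + b \<in> C"
    and "\<And>b. b \<in> zonotope ys \<Longrightarrow> f (z + b) \<le> M" and s: "0 \<le> s" "s \<le> 1"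
  shows "f (z + s *\<^sub>R sum_list ys) - M \<le> (1 - s) ^ length ys * (f z - M)"
    and "f z - M \<le> (1 - s) ^ length ys * (f (z + s *\<^sub>R sum_list ys) - M)"
proof -
  have "f (z + s *\<^sub>R sum_list ys) - M \<le> (1 - s) ^ length ys * (f z - M) \<and>
    f z - M \<le> (1 - s) ^ length ys * (f (z + s *\<^sub>R sum_list ys) - M)"
    using assms(3-5)
  proof (induction ys arbitrary: z)
    case (Cons y ys)
    define z' where "z' = z + s *\<^sub>R y"
    have s': "\<bar>s\<bar> \<le> 1" using s by simp
    have in_z: "z' + b = z + (s *\<^sub>R y + b)" for b
      by (simp add: z'_def add.assoc)
    have sub: "z' + b \<in> C" "f (z' + b) \<le> M" if "b \<in> zonotope ys" for b
      unfolding in_z using Cons.prems(2,3) zonotope_ConsI[OF s' that] by blast+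
    have IH: "f (z' + s *\<^sub>R sum_list ys) - M \<le> (1 - s) ^ length ys * (f z' - M)"
      "f z' - M \<le> (1 - s) ^ length ys * (f (z' + s *\<^sub>R sum_list ys) - M)"
      using Cons.IH[OF _ sub] Cons.prems(1) by auto
    have step: "f (z + (((1 - u) * p + u * q) *\<^sub>R y + 0))
        \<le> (1 - u) * f (z + (p *\<^sub>R y + 0)) + u * f (z + (q *\<^sub>R y + 0))"
      if "\<bar>p\<bar> \<le> 1" "\<bar>q\<bar> \<le> 1" "0 \<le> u" "u \<le> 1" for p q u
      using Cons.prems(1)
      by (intro directional_bound_zonotope[OF D f _ Cons.prems(2)] zero_in_zonotope that) auto
    have M: "f (z + (q *\<^sub>R y + 0)) \<le> M" if "\<bar>q\<bar> \<le> 1" for q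
      by (intro Cons.prems(3) zonotope_ConsI that zero_in_zonotope)
    \<comment> \<open>Forwards, the step heads from coordinate 0 towards coordinate 1; backwards, it heads from
      coordinate \<open>s\<close> towards \<open>s - 1\<close> and passes 0 at the fraction \<open>s\<close> of the way.\<close>
    have "f z' \<le> (1 - s) * f z + s * f (z + y)"
      using step[of 0 1 s] s by (simp add: z'_def)
    also have "\<dots> \<le> (1 - s) * f z + s * M"
      using M[of 1] s by (intro add_left_mono mult_left_mono) auto
    finally have up: "f z' - M \<le> (1 - s) * (f z - M)"
      by (simp add: algebra_simps)
    have "(1 - s) * s + s * (s - 1) = 0" by (simp add: algebra_simps)
    then have "f z \<le> (1 - s) * f z' + s * f (z + ((s - 1) *\<^sub>R y + 0))"
      using step[of s "s - 1" s] s by (simp add: z'_def)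
    also have "\<dots> \<le> (1 - s) * f z' + s * M"
      using M[of "s - 1"] s by (intro add_left_mono mult_left_mono) auto
    finally have down: "f z - M \<le> (1 - s) * (f z' - M)"
      by (simp add: algebra_simps)
    have end_eq: "z' + s *\<^sub>R sum_list ys = z + s *\<^sub>R sum_list (y # ys)"
      by (simp add: z'_def algebra_simps)
    have "f (z + s *\<^sub>R sum_list (y # ys)) - M \<le> (1 - s) ^ length ys * ((1 - s) * (f z - M))"
      using IH(1) mult_left_mono[OF up, of "(1 - s) ^ length ys"] s unfolding end_eq by simp
    moreover have "f z - M \<le> (1 - s) * ((1 - s) ^ length ys * (f (z + s *\<^sub>R sum_list (y # ys)) - M))"
      using down mult_left_mono[OF IH(2), of "1 - s"] s unfolding end_eq by simp
    ultimately show ?case by (simp add: mult_ac)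
  qed simp
  then show "f (z + s *\<^sub>R sum_list ys) - M \<le> (1 - s) ^ length ys * (f z - M)"
    "f z - M \<le> (1 - s) ^ length ys * (f (z + s *\<^sub>R sum_list ys) - M)" by auto
qed

lemma zonotope_in_open:
  fixes z :: "'a::real_normed_vector"
  assumes "open C" "z \<in> C"
  obtains \<epsilon> :: real where "\<epsilon> > 0" "\<And>b. b \<in> zonotope (map (scaleR \<epsilon>) ys) \<Longrightarrow> z + b \<in> C"
proof -
  obtain e where e: "e > 0" "ball z e \<subseteq> C"
    using assms open_contains_ball by blast
  define N where "N = (\<Sum>y\<leftarrow>ys. norm y)"
  have N: "N \<ge> 0" unfolding N_def by (induction ys) auto
  define \<epsilon> where "\<epsilon> = e / (N + 1)"
  have \<epsilon>: "\<epsilon> > 0" "\<epsilon> * N < e"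
    using e N by (auto simp: \<epsilon>_def field_simps)
  have "z + b \<in> C" if "b \<in> zonotope (map (scaleR \<epsilon>) ys)" for b
  proof -
    have "norm b \<le> (\<Sum>y\<leftarrow>ys. \<epsilon> * norm y)"
      using norm_zonotope_le[OF that] \<epsilon> by (simp add: o_def)
    also have "\<dots> = \<epsilon> * N"
      by (simp add: N_def sum_list_const_mult)
    finally show ?thesis
      using \<epsilon> e by (auto simp: subset_iff dist_norm)
  qed
  with \<epsilon> that show thesis by blast
qed

text \<open>Write \<open>v\<close> as a sum of elements of \<open>D\<close>, shrink them so that their zonotope at \<open>z\<close> lies in
  \<open>C\<close>, and linearise the factor \<open>(1 - s)\<^sup>n\<close> of the walk estimate by Bernoulli's inequality.\<close>

lemma directionally_convex_Lipschitz_along_rays: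
  fixes f :: "'a::real_normed_vector \<Rightarrow> real"
  assumes C: "open C" and D: "cone_of_directions D" and f: "directionally_convex_on D C f"
    and z: "z \<in> C"
  obtains \<delta> K where "\<delta> > 0" "\<forall>s\<in>{0..\<delta>}. z + s *\<^sub>R v \<in> C"
    "\<forall>s\<in>{0..\<delta>}. \<bar>f (z + s *\<^sub>R v) - f z\<bar> \<le> K * s"
proof -
  have D': "\<And>x t. x \<in> D \<Longrightarrow> t *\<^sub>R x \<in> D"
    using D by (auto simp: cone_of_directions_def)
  obtain ys where ys: "set ys \<subseteq> D" "sum_list ys = v"
    using spanning_cone_sum_list[OF D] .
  obtain \<epsilon> where \<epsilon>: "\<epsilon> > 0" "\<And>b. b \<in> zonotope (map (scaleR \<epsilon>) ys) \<Longrightarrow> z + b \<in> C"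
    using zonotope_in_open[OF C z, of ys] by blast
  define ws where "ws = map (scaleR \<epsilon>) ys"
  define n where "n = length ws"
  have wsD: "set ws \<subseteq> D" using ys D' by (auto simp: ws_def)
  have sum_ws: "sum_list ws = \<epsilon> *\<^sub>R v"
    unfolding ws_def ys(2)[symmetric] by (induction ys) (auto simp: algebra_simps)
  have ws_C: "\<And>b. b \<in> zonotope ws \<Longrightarrow> z + b \<in> C" using \<epsilon> by (simp add: ws_def)
  obtain M where M: "\<And>b. b \<in> zonotope ws \<Longrightarrow> f (z + b) \<le> M"
    using bounded_above_on_zonotope[OF D' f wsD ws_C] by blast
  have Mz: "f z \<le> M" using M[OF zero_in_zonotope] by simp
  obtain e where e: "e > 0" "ball z e \<subseteq> C"
    using C z open_contains_ball by blast
  \<comment> \<open>The first bound gives \<open>n s \<le> 1/2\<close> for \<open>s \<le> r\<close>, so that the factor \<open>1 - n s\<close> can be divided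
    out; the second keeps the ray inside a ball contained in \<open>C\<close>.\<close>
  define r where "r = min (1 / (2 * (real n + 1))) (e / (\<epsilon> * (norm v + 1)))"
  have r0: "r > 0" using e \<epsilon> by (auto simp: r_def add_nonneg_pos)
  have r1: "r * real n \<le> 1/2"
  proof -
    have "r \<le> 1 / (2 * (real n + 1))" by (simp add: r_def)
    then have "r * real n \<le> 1 / (2 * (real n + 1)) * real n" by (intro mult_right_mono) auto
    also have "\<dots> \<le> 1/2" by (simp add: field_simps)
    finally show ?thesis .
  qed
  have r2: "r \<le> 1"
  proof -
    have "1 / (2 * (real n + 1)) \<le> 1" by (simp add: field_simps)
    then show ?thesis unfolding r_def by linarith
  qed
  have r3: "r * \<epsilon> * norm v < e"
  proof -
    have "r \<le> e / (\<epsilon> * (norm v + 1))" by (simp add: r_def)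
    then have "r * (\<epsilon> * (norm v + 1)) \<le> e"
      using \<epsilon> by (simp add: pos_le_divide_eq add_nonneg_pos)
    moreover have "r * \<epsilon> > 0" using r0 \<epsilon> by simp
    ultimately show ?thesis by (simp add: algebra_simps)
  qed
  have main: "\<bar>f (z + s *\<^sub>R (\<epsilon> *\<^sub>R v)) - f z\<bar> \<le> 2 * real n * (M - f z) * s" if s: "0 \<le> s" "s \<le> r" for s
  proof -
    define p where "p = (1 - s) ^ n"
    have s1: "s \<le> 1" using s r2 by linarith
    have p2: "1 - real n * s \<le> p"
      unfolding p_def using Bernoulli_inequality[of "-s" n] s1 by simp
    have ns: "real n * s \<le> 1/2" 
      using mult_right_mono[OF s(2), of "real n"] r1 by (simp add: mult.commute)
    have ns0: "0 \<le> real n * s" using s by simp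
    note walk = zonotope_walk[OF D' f wsD ws_C M s(1) s1, folded n_def, folded p_def, unfolded sum_ws]
    define f' where "f' = f (z + s *\<^sub>R (\<epsilon> *\<^sub>R v))"
    have up: "f' - f z \<le> real n * s * (M - f z)"
    proof -
      have "f' - f z \<le> (1 - p) * (M - f z)"
        using walk(1) by (simp add: f'_def algebra_simps)
      also have "\<dots> \<le> real n * s * (M - f z)"
        using p2 Mz by (intro mult_right_mono) auto
      finally show ?thesis .
    qed
    have down: "f z - f' \<le> 2 * real n * s * (M - f z)"
    proof (cases "f' \<ge> f z")
      case True
      then show ?thesis using Mz s by (smt (verit) mult_nonneg_nonneg of_nat_0_le_iff)
    next
      case False
      have "(1 - real n * s) * (M - f') \<le> p * (M - f')"
        using p2 False Mz by (intro mult_right_mono) auto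
      also have "\<dots> \<le> M - f z"
        using walk(2) by (simp add: f'_def algebra_simps)
      finally have "(1 - real n * s) * (M - f') \<le> M - f z" .
      then have *: "(1 - real n * s) * (f z - f') \<le> real n * s * (M - f z)"
        by (simp add: algebra_simps)
      have "(1/2) * (f z - f') \<le> (1 - real n * s) * (f z - f')"
        using ns False by (intro mult_right_mono) auto
      with * show ?thesis by simp
    qed
    have "0 \<le> real n * s * (M - f z)" using ns0 Mz by simp
    moreover have "2 * real n * (M - f z) * s = 2 * (real n * s * (M - f z))"
      "2 * real n * s * (M - f z) = 2 * (real n * s * (M - f z))" by simp_all
    ultimately show ?thesis using up down unfolding f'_def[symmetric] by linarith
  qed
  show thesis
  proof
    show "r * \<epsilon> > 0" using r0 \<epsilon> by simp
    show "\<forall>s\<in>{0..r * \<epsilon>}. z + s *\<^sub>R v \<in> C"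
    proof
      fix s assume s: "s \<in> {0..r * \<epsilon>}"
      then have "s * norm v \<le> r * \<epsilon> * norm v" by (intro mult_right_mono) auto
      then have "norm (s *\<^sub>R v) < e" using r3 s by simp
      then show "z + s *\<^sub>R v \<in> C" using e by (auto simp: subset_iff dist_norm)
    qed
    show "\<forall>s\<in>{0..r * \<epsilon>}. \<bar>f (z + s *\<^sub>R v) - f z\<bar> \<le> (2 * real n * (M - f z) / \<epsilon>) * s"
    proof
      fix s assume "s \<in> {0..r * \<epsilon>}"
      then show "\<bar>f (z + s *\<^sub>R v) - f z\<bar> \<le> (2 * real n * (M - f z) / \<epsilon>) * s"
        using main[of "s / \<epsilon>"] \<epsilon>(1) by (simp add: field_simps)
    qed
  qed
qed

section \<open>Blowing up at a point of the cone\<close>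

text \<open>The point \<open>x + y\<close> lies between \<open>x\<close> and the far point \<open>x + y/s\<close> on a ray of convexity,
  and the far point contributes \<open>s f (x + y/s) = f (y + s x)\<close>, which tends to \<open>f y\<close> as \<open>s\<close> tends
  to 0.\<close>

lemma subadditive_along_direction:
  fixes f :: "'a::real_normed_vector \<Rightarrow> real"
  assumes C: "open_convex_cone C" and D: "cone_of_directions D"
    and f: "directionally_convex_on D C f" and hom: "positively_1_homogeneous_on C f"
    and y: "y \<in> C \<inter> D" and x: "x \<in> C"
  shows "f (x + y) \<le> f x + f y"
proof -
  have "open C" using C by (simp add: open_convex_cone_def)
  obtain \<delta> K where \<delta>: "\<delta> > 0" "\<forall>s\<in>{0..\<delta>}. y + s *\<^sub>R x \<in> C"
    "\<forall>s\<in>{0..\<delta>}. \<bar>f (y + s *\<^sub>R x) - f y\<bar> \<le> K * s"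
    using directionally_convex_Lipschitz_along_rays[OF \<open>open C\<close> D f IntD1[OF y], where v = x] .
  have ev: "f (x + y) \<le> (1 - s) * f x + f y + K * s" if s: "0 < s" "s \<le> min \<delta> 1" for s
  proof -
    have xt: "x + (1/s) *\<^sub>R y \<in> C"
      using C x y s by (intro open_convex_cone_add open_convex_cone_scale) auto
    have dir: "x - (x + (1/s) *\<^sub>R y) \<in> D"
    proof -
      have "x - (x + (1/s) *\<^sub>R y) = (- (1/s)) *\<^sub>R y" by simp
      then show ?thesis using D y unfolding cone_of_directions_def by (metis IntD2)
    qed
    have "f ((1 - s) *\<^sub>R x + s *\<^sub>R (x + (1/s) *\<^sub>R y)) \<le> (1 - s) * f x + s * f (x + (1/s) *\<^sub>R y)"
      using s xt x open_convex_cone_imp_convex[OF C]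
      by (intro directionally_convex_onD[OF f _ dir] closed_segment_subset) auto
    moreover have "(1 - s) *\<^sub>R x + s *\<^sub>R (x + (1/s) *\<^sub>R y) = x + y"
      using s by (simp add: algebra_simps)
    moreover have "s * f (x + (1/s) *\<^sub>R y) = f (y + s *\<^sub>R x)"
    proof -
      have "s * f (x + (1/s) *\<^sub>R y) = f (s *\<^sub>R (x + (1/s) *\<^sub>R y))"
        using hom s xt by (simp add: positively_1_homogeneous_on_def)
      also have "s *\<^sub>R (x + (1/s) *\<^sub>R y) = y + s *\<^sub>R x"
        using s by (simp add: algebra_simps)
      finally show ?thesis .
    qed
    moreover have "f (y + s *\<^sub>R x) \<le> f y + K * s"
      using \<delta>(3)[rule_format, of s] s by auto
    ultimately show ?thesis by simp
  qed
  have "((\<lambda>s. (1 - s) * f x + f y + K * s) \<longlongrightarrow> (1 - 0) * f x + f y + K * 0) (at_right 0)"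
    by (intro tendsto_intros)
  moreover have "eventually (\<lambda>s. f (x + y) \<le> (1 - s) * f x + f y + K * s) (at_right 0)"
    unfolding eventually_at_right_field using ev \<delta>(1)
    by (intro exI[of _ "min \<delta> 1"]) auto
  ultimately show ?thesis
    using tendsto_lowerbound[of "\<lambda>s. (1 - s) * f x + f y + K * s" "f x + f y" "at_right 0"]
    by simp
qed

lemma eventually_translate_in_cone:
  assumes C: "open_convex_cone C" and x0: "x0 \<in> C"
  shows "eventually (\<lambda>t. v + t *\<^sub>R x0 \<in> C) at_top"
proof -
  have "((\<lambda>t. x0 + inverse t *\<^sub>R v) \<longlongrightarrow> x0 + 0 *\<^sub>R v) at_top"
    by (intro tendsto_intros tendsto_inverse_0_at_top filterlim_ident)
  then have "eventually (\<lambda>t. x0 + inverse t *\<^sub>R v \<in> C) at_top"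
    using C x0 topological_tendstoD[of _ x0 at_top C] by (simp add: open_convex_cone_def)
  then show ?thesis
    using eventually_gt_at_top[of 0]
  proof eventually_elim
    case (elim t)
    have "t *\<^sub>R (x0 + inverse t *\<^sub>R v) \<in> C"
      using C elim by (intro open_convex_cone_scale)
    also have "t *\<^sub>R (x0 + inverse t *\<^sub>R v) = v + t *\<^sub>R x0"
      using elim by (simp add: algebra_simps)
    finally show ?case .
  qed
qed

definition blow_up :: "('a::real_vector \<Rightarrow> real) \<Rightarrow> 'a \<Rightarrow> 'a \<Rightarrow> real" where
  "blow_up f x0 v = Lim at_top (\<lambda>t. f (v + t *\<^sub>R x0) - t * f x0)"

lemma blow_upI:
  "((\<lambda>t. f (v + t *\<^sub>R x0) - t * f x0) \<longlongrightarrow> L) at_top \<Longrightarrow> blow_up f x0 v = L"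
  unfolding blow_up_def by (intro tendsto_Lim) auto

locale directionally_convex_cone =
  fixes C D :: "'a::real_normed_vector set" and f :: "'a \<Rightarrow> real"
  assumes C: "open_convex_cone C" and D: "cone_of_directions D"
    and f: "directionally_convex_on D C f" and hom: "positively_1_homogeneous_on C f"
begin

lemma translate_antimono:
  assumes x0: "x0 \<in> C \<inter> D" and "v + s *\<^sub>R x0 \<in> C" "s \<le> t"
  shows "v + t *\<^sub>R x0 \<in> C" "f (v + t *\<^sub>R x0) - t * f x0 \<le> f (v + s *\<^sub>R x0) - s * f x0"
proof -
  have "v + t *\<^sub>R x0 \<in> C \<and> f (v + t *\<^sub>R x0) - t * f x0 \<le> f (v + s *\<^sub>R x0) - s * f x0"
  proof (cases "s = t")
    case True
    then show ?thesis using assms by simp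
  next
    case False
    define r where "r = t - s"
    have r: "r > 0" using False assms by (simp add: r_def)
    have rx0: "r *\<^sub>R x0 \<in> C \<inter> D"
      using x0 D open_convex_cone_scale[OF C _ r] by (simp add: cone_of_directions_def)
    have eq: "v + t *\<^sub>R x0 = (v + s *\<^sub>R x0) + r *\<^sub>R x0"
      by (simp add: r_def algebra_simps)
    have "f (r *\<^sub>R x0) = r * f x0"
      using hom r x0 by (simp add: positively_1_homogeneous_on_def)
    then have "f (v + t *\<^sub>R x0) \<le> f (v + s *\<^sub>R x0) + r * f x0"
      using subadditive_along_direction[OF C D f hom rx0 assms(2)] unfolding eq by simp
    moreover have "v + t *\<^sub>R x0 \<in> C"
      unfolding eq using rx0 by (intro open_convex_cone_add[OF C assms(2)]) auto
    ultimately show ?thesis by (simp add: r_def algebra_simps)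
  qed
  then show "v + t *\<^sub>R x0 \<in> C" "f (v + t *\<^sub>R x0) - t * f x0 \<le> f (v + s *\<^sub>R x0) - s * f x0" by auto
qed

text \<open>The decreasing function under the limit converges because it is bounded below: it equals
  \<open>t (f (x0 + v/t) - f x0)\<close>, to which the Lipschitz bound along the ray from \<open>x0\<close> in direction
  \<open>v\<close> applies.\<close>

lemma tendsto_blow_up:
  assumes x0: "x0 \<in> C \<inter> D"
  shows "((\<lambda>t. f (v + t *\<^sub>R x0) - t * f x0) \<longlongrightarrow> blow_up f x0 v) at_top"
proof -
  define \<phi> where "\<phi> t = f (v + t *\<^sub>R x0) - t * f x0" for t
  have "open C" using C by (simp add: open_convex_cone_def)
  obtain \<delta> K where \<delta>: "\<delta> > 0" "\<forall>s\<in>{0..\<delta>}. x0 + s *\<^sub>R v \<in> C"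
    "\<forall>s\<in>{0..\<delta>}. \<bar>f (x0 + s *\<^sub>R v) - f x0\<bar> \<le> K * s"
    using directionally_convex_Lipschitz_along_rays[OF \<open>open C\<close> D f IntD1[OF x0], where v = v] .
  define T where "T = 1 / \<delta>"
  have T: "T > 0" using \<delta> by (simp add: T_def)
  have low: "v + t *\<^sub>R x0 \<in> C \<and> - K \<le> \<phi> t" if "t \<ge> T" for t
  proof -
    have t: "t > 0" using that T by simp
    moreover have "1 / t \<le> \<delta>" using that t \<delta>(1) by (simp add: T_def field_simps)
    ultimately have t: "t > 0" "1 / t \<le> \<delta>" by simp_all
    have x: "x0 + (1/t) *\<^sub>R v \<in> C" using \<delta>(2)[rule_format, of "1/t"] t by simp
    have eq: "t *\<^sub>R (x0 + (1/t) *\<^sub>R v) = v + t *\<^sub>R x0" using t by (simp add: algebra_simps)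
    have "f (v + t *\<^sub>R x0) = t * f (x0 + (1/t) *\<^sub>R v)"
      using hom t x unfolding eq[symmetric] by (simp add: positively_1_homogeneous_on_def)
    then have "\<phi> t = t * (f (x0 + (1/t) *\<^sub>R v) - f x0)"
      by (simp add: \<phi>_def algebra_simps)
    also have "\<dots> \<ge> t * (- (K * (1/t)))"
      using \<delta>(3)[rule_format, of "1/t"] t by (intro mult_left_mono) auto
    finally have "- K \<le> \<phi> t" using t by simp
    with open_convex_cone_scale[OF C x t(1)] eq show ?thesis by simp
  qed
  define L where "L = Inf (\<phi> ` {T..})"
  have bdd: "bdd_below (\<phi> ` {T..})"
    using low by (intro bdd_belowI[of _ "- K"]) auto
  have "(\<phi> \<longlongrightarrow> L) at_top"
  proof (rule decreasing_tendsto)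
    show "eventually (\<lambda>t. L \<le> \<phi> t) at_top"
      using eventually_ge_at_top[of T]
      by eventually_elim (auto simp: L_def intro!: cInf_lower bdd)
  next
    fix x assume "L < x"
    then obtain s where s: "s \<ge> T" "\<phi> s < x"
      using cInf_less_iff[OF _ bdd] unfolding L_def by auto
    show "eventually (\<lambda>t. \<phi> t < x) at_top"
      using eventually_ge_at_top[of s]
    proof eventually_elim
      case (elim t)
      have "\<phi> t \<le> \<phi> s"
        using translate_antimono(2)[OF x0 _ elim] low[OF s(1)] by (simp add: \<phi>_def)
      with s show ?case by simp
    qed
  qed
  then show ?thesis
    using blow_upI[of f v x0 L] by (simp add: \<phi>_def[abs_def])
qed

lemma blow_up_le:
  assumes x0: "x0 \<in> C \<inter> D" and v: "v \<in> C"
  shows "blow_up f x0 v \<le> f v"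
proof (rule tendsto_upperbound[OF tendsto_blow_up[OF x0]])
  show "eventually (\<lambda>t. f (v + t *\<^sub>R x0) - t * f x0 \<le> f v) at_top"
    using eventually_ge_at_top[of 0]
    by eventually_elim (use translate_antimono(2)[OF x0, of v 0] v in auto)
qed simp

lemma blow_up_homogeneous:
  assumes x0: "x0 \<in> C \<inter> D"
  shows "positively_1_homogeneous_on UNIV (blow_up f x0)"
  unfolding positively_1_homogeneous_on_def
proof (intro allI impI ballI)
  fix s :: real and v :: 'a
  assume s: "s > 0"
  have lim: "filterlim (\<lambda>t. t / s) at_top at_top"
    using filterlim_tendsto_pos_mult_at_top[of "\<lambda>_. 1/s" "1/s" at_top "\<lambda>t. t"] s
    by (simp add: filterlim_ident)
  have "((\<lambda>t. s * (f (v + (t / s) *\<^sub>R x0) - t / s * f x0)) \<longlongrightarrow> s * blow_up f x0 v) at_top"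
    using filterlim_compose[OF tendsto_blow_up[OF x0] lim] by (intro tendsto_mult_left)
  moreover have "eventually (\<lambda>t. s * (f (v + (t / s) *\<^sub>R x0) - t / s * f x0)
      = f (s *\<^sub>R v + t *\<^sub>R x0) - t * f x0) at_top"
    using eventually_compose_filterlim[OF eventually_translate_in_cone[OF C IntD1[OF x0], of v] lim]
  proof eventually_elim
    case (elim t)
    have "s * f (v + (t / s) *\<^sub>R x0) = f (s *\<^sub>R (v + (t / s) *\<^sub>R x0))"
      using hom elim s by (simp add: positively_1_homogeneous_on_def)
    then show ?case using s by (simp add: algebra_simps)
  qed
  ultimately have "((\<lambda>t. f (s *\<^sub>R v + t *\<^sub>R x0) - t * f x0) \<longlongrightarrow> s * blow_up f x0 v) at_top"
    by (rule Lim_transform_eventually)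
  then show "blow_up f x0 (s *\<^sub>R v) = s * blow_up f x0 v"
    by (rule blow_upI)
qed

lemma blow_up_translate:
  assumes x0: "x0 \<in> C \<inter> D"
  shows "blow_up f x0 (v + r *\<^sub>R x0) = blow_up f x0 v + r * f x0"
proof (rule blow_upI)
  have "filterlim (\<lambda>t::real. r + t) at_top at_top"
    by (rule filterlim_tendsto_add_at_top[OF tendsto_const filterlim_ident])
  from filterlim_compose[OF tendsto_blow_up[OF x0] this]
  have "((\<lambda>t. f (v + (r + t) *\<^sub>R x0) - (r + t) * f x0 + r * f x0)
      \<longlongrightarrow> blow_up f x0 v + r * f x0) at_top"
    by (intro tendsto_add tendsto_const)
  then show "((\<lambda>t. f (v + r *\<^sub>R x0 + t *\<^sub>R x0) - t * f x0) \<longlongrightarrow> blow_up f x0 v + r * f x0) at_top"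
    by (simp add: algebra_simps)
qed

lemma blow_up_directionally_convex:
  assumes x0: "x0 \<in> C \<inter> D"
  shows "directionally_convex_on D UNIV (blow_up f x0)"
proof (rule directionally_convex_onI)
  show "\<And>x t. x \<in> D \<Longrightarrow> t *\<^sub>R x \<in> D" using D by (auto simp: cone_of_directions_def)
next
  fix a b :: 'a and u :: real
  assume ab: "a - b \<in> D" and u: "0 < u" "u < 1"
  show "blow_up f x0 ((1 - u) *\<^sub>R a + u *\<^sub>R b) \<le> (1 - u) * blow_up f x0 a + u * blow_up f x0 b"
  proof (rule tendsto_le[OF _ _ tendsto_blow_up[OF x0]])
    show "((\<lambda>t. (1 - u) * (f (a + t *\<^sub>R x0) - t * f x0) + u * (f (b + t *\<^sub>R x0) - t * f x0))
      \<longlongrightarrow> (1 - u) * blow_up f x0 a + u * blow_up f x0 b) at_top"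
      by (intro tendsto_intros tendsto_blow_up x0)
    have "eventually (\<lambda>t. a + t *\<^sub>R x0 \<in> C) at_top" "eventually (\<lambda>t. b + t *\<^sub>R x0 \<in> C) at_top"
      using eventually_translate_in_cone[OF C] x0 by auto
    then show "eventually (\<lambda>t. f ((1 - u) *\<^sub>R a + u *\<^sub>R b + t *\<^sub>R x0) - t * f x0
      \<le> (1 - u) * (f (a + t *\<^sub>R x0) - t * f x0) + u * (f (b + t *\<^sub>R x0) - t * f x0)) at_top"
    proof eventually_elim
      case (elim t)
      have "closed_segment (a + t *\<^sub>R x0) (b + t *\<^sub>R x0) \<subseteq> C"
        using elim open_convex_cone_imp_convex[OF C] by (intro closed_segment_subset)
      from directionally_convex_onD[OF f this, of u] ab u
      show ?case by (simp add: algebra_simps)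
    qed
  qed simp
qed

lemma blow_up_directionally_convex_cone:
  assumes "x0 \<in> C \<inter> D"
  shows "directionally_convex_cone UNIV D (blow_up f x0)"
  using assms open_convex_cone_UNIV D blow_up_directionally_convex blow_up_homogeneous
  by unfold_locales

end

lemma positively_1_homogeneous_on_zero:
  assumes "positively_1_homogeneous_on UNIV g"
  shows "g 0 = 0"
proof -
  have "g (2 *\<^sub>R 0) = 2 * g 0"
    using assms unfolding positively_1_homogeneous_on_def by (metis UNIV_I zero_less_numeral)
  then show ?thesis by simp
qed

section \<open>Directions of linearity\<close>

text \<open>For a sublinear \<open>g\<close> this is its lineality space.\<close>

definition lineality :: "('a::real_vector \<Rightarrow> real) \<Rightarrow> 'a set" where
  "lineality g = {e. \<forall>v r. g (v + r *\<^sub>R e) = g v + r * g e}"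

lemma subspace_lineality:
  assumes "g 0 = 0"
  shows "subspace (lineality g)"
proof (rule subspaceI)
  show "0 \<in> lineality g" using assms by (simp add: lineality_def)
next
  fix x y assume x: "x \<in> lineality g" and y: "y \<in> lineality g"
  have gy: "g (v + r *\<^sub>R y) = g v + r * g y" for v r using y by (simp add: lineality_def)
  have gx: "g (v + r *\<^sub>R x) = g v + r * g x" for v r using x by (simp add: lineality_def)
  have "g (x + y) = g x + g y" using gy[of x 1] by simp
  moreover have "g (v + r *\<^sub>R (x + y)) = g v + r * g x + r * g y" for v r
    using gy[of "v + r *\<^sub>R x" r] gx[of v r] by (simp add: algebra_simps)
  ultimately show "x + y \<in> lineality g" by (simp add: lineality_def algebra_simps)
next
  fix c :: real and x assume x: "x \<in> lineality g"
  have gx: "g (v + r *\<^sub>R x) = g v + r * g x" for v r using x by (simp add: lineality_def)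
  have "g (c *\<^sub>R x) = c * g x" using gx[of 0 c] assms by simp
  then show "c *\<^sub>R x \<in> lineality g" using gx by (simp add: lineality_def)
qed

lemma linear_if_lineality_UNIV:
  assumes "g 0 = 0" "lineality g = UNIV"
  shows "linear g"
proof -
  have g: "g (v + r *\<^sub>R e) = g v + r * g e" for v r e using assms(2) by (auto simp: lineality_def)
  show ?thesis
    using g[of _ 1] g[of 0] assms(1) by (intro linearI) auto
qed

lemma (in directionally_convex_cone) blow_up_base_point:
  assumes x0: "x0 \<in> C \<inter> D"
  shows "x0 \<in> lineality (blow_up f x0)" "blow_up f x0 x0 = f x0"
proof -
  have "blow_up f x0 0 = 0"
    by (rule positively_1_homogeneous_on_zero[OF blow_up_homogeneous[OF x0]])
  then show "blow_up f x0 x0 = f x0"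
    using blow_up_translate[OF x0, of 0 1] by simp
  then show "x0 \<in> lineality (blow_up f x0)"
    using blow_up_translate[OF x0] by (simp add: lineality_def)
qed

text \<open>Blowing up at \<open>y\<close> only translates \<open>g\<close> and subtracts constants, so every direction of
  linearity survives with its slope.\<close>

lemma blow_up_lineality:
  assumes g: "directionally_convex_cone UNIV D g" and y: "y \<in> D" and e: "e \<in> lineality g"
  shows "blow_up g y e = g e" "e \<in> lineality (blow_up g y)"
proof -
  interpret directionally_convex_cone UNIV D g by (rule g)
  have ge: "g (v + r *\<^sub>R e) = g v + r * g e" for v r using e by (simp add: lineality_def)
  have tr: "blow_up g y (v + r *\<^sub>R e) = blow_up g y v + r * g e" for v r
  proof (rule blow_upI)
    have "((\<lambda>t. g (v + t *\<^sub>R y) - t * g y + r * g e) \<longlongrightarrow> blow_up g y v + r * g e) at_top"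
      using tendsto_blow_up[of y v] y by (intro tendsto_intros) auto
    moreover have "g (v + r *\<^sub>R e + t *\<^sub>R y) = g (v + t *\<^sub>R y) + r * g e" for t
      using ge[of "v + t *\<^sub>R y" r] by (simp add: add_ac)
    ultimately show "((\<lambda>t. g (v + r *\<^sub>R e + t *\<^sub>R y) - t * g y) \<longlongrightarrow> blow_up g y v + r * g e) at_top"
      by (simp add: algebra_simps)
  qed
  have "blow_up g y 0 = 0"
    using positively_1_homogeneous_on_zero[OF blow_up_homogeneous] y by simp
  then show "blow_up g y e = g e" using tr[of 0 1] by simp
  then show "e \<in> lineality (blow_up g y)" using tr by (simp add: lineality_def)
qed

lemma iterated_blow_up:
  assumes "finite B" "B \<subseteq> D" and "directionally_convex_cone UNIV D g"
  shows "\<exists>h. directionally_convex_cone UNIV D h \<and> (\<forall>v. h v \<le> g v) \<and>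
    (\<forall>e\<in>lineality g. h e = g e) \<and> lineality g \<union> B \<subseteq> lineality h"
  using assms(1,2)
proof (induction rule: finite_induct)
  case empty
  then show ?case using assms(3) by blast
next
  case (insert y B)
  then obtain h where h: "directionally_convex_cone UNIV D h" "\<And>v. h v \<le> g v"
    "\<And>e. e \<in> lineality g \<Longrightarrow> h e = g e" "lineality g \<union> B \<subseteq> lineality h"
    by auto
  interpret directionally_convex_cone UNIV D h by (rule h)
  have y: "y \<in> UNIV \<inter> D" using insert by auto
  show ?case
  proof (intro exI[of _ "blow_up h y"] conjI allI ballI)
    show "directionally_convex_cone UNIV D (blow_up h y)"
      by (rule blow_up_directionally_convex_cone[OF y])
    show "blow_up h y v \<le> g v" for v
      using blow_up_le[OF y, of v] h(2)[of v] by simp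
    show "blow_up h y e = g e" if "e \<in> lineality g" for e
      using blow_up_lineality(1)[OF h(1), of y e] h(3,4) that y by auto
    show "lineality g \<union> insert y B \<subseteq> lineality (blow_up h y)"
      using blow_up_lineality(2)[OF h(1), of y] h(4) y blow_up_base_point(1)[OF y] by auto
  qed
qed

lemma finite_spanning_subset:
  fixes D :: "'a::real_vector set"
  assumes "finite_dimensional_space TYPE('a)" "span D = UNIV"
  obtains B where "finite B" "B \<subseteq> D" "span B = UNIV"
proof -
  obtain B where B: "B \<subseteq> D" "independent B" "D \<subseteq> span B"
    by (rule maximal_independent_subset)
  obtain A :: "'a set" where A: "finite A" "span A = UNIV"
    using assms(1) by (auto simp: finite_dimensional_space_def)
  have "finite B" using independent_span_bound[OF A(1) B(2)] A(2) by simp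
  moreover have "span B = UNIV"
    using span_mono[OF B(3)] assms(2) by (simp add: span_span top.extremum_unique)
  ultimately show thesis using that B by blast
qed

theorem theorem1p1:
  fixes C D :: "'a::real_normed_vector set" and f :: "'a \<Rightarrow> real"
  assumes "finite_dimensional_space TYPE('a)"
    and "open_convex_cone C"
    and "cone_of_directions D"
    and "directionally_convex_on D C f"
    and "positively_1_homogeneous_on C f"
  shows "\<forall>x0 \<in> C \<inter> D. \<exists>l :: 'a \<Rightarrow> real. linear l \<and> l x0 = f x0 \<and> (\<forall>x\<in>C. f x \<ge> l x)"
proof
  fix x0 assume x0: "x0 \<in> C \<inter> D"
  interpret directionally_convex_cone C D f
    using assms by unfold_locales
  obtain B where B: "finite B" "B \<subseteq> D" "span B = UNIV"
    using finite_spanning_subset assms(1,3) unfolding cone_of_directions_def by blast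
  define g where "g = blow_up f x0"
  obtain h where h: "directionally_convex_cone UNIV D h" "\<And>v. h v \<le> g v"
    "\<And>e. e \<in> lineality g \<Longrightarrow> h e = g e" "B \<subseteq> lineality h"
    using iterated_blow_up[OF B(1,2) blow_up_directionally_convex_cone[OF x0]]
    unfolding g_def by blast
  have h0: "h 0 = 0"
    using h(1) by (intro positively_1_homogeneous_on_zero directionally_convex_cone.hom)
  have "linear h"
    using span_minimal[OF h(4) subspace_lineality[of h]] B(3) h0
    by (intro linear_if_lineality_UNIV) auto
  moreover have "h x0 = f x0"
    using h(3) blow_up_base_point[OF x0] by (simp add: g_def)
  moreover have "h x \<le> f x" if "x \<in> C" for x
    using h(2)[of x] blow_up_le[OF x0 that] by (simp add: g_def)
  ultimately show "\<exists>l. linear l \<and> l x0 = f x0 \<and> (\<forall>x\<in>C. f x \<ge> l x)"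
    by blast
qed

end
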